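(* Let $k,n\ge 1$, let the reparametrization group $G_k$ act on the space $J_k\mathbb{C}^n$ of $k$-jets of holomorphic curves in $\mathbb{C}^n$, and let $x\in J_k\mathbb{C}^n$ be a generic point. Put $\Omega=(J_k\mathbb{C}^n)^{\mathfrak{g}_{k,x}}$. Then: - the set $G_k.\Omega$ is dense in $J_k\mathbb{C}^n$; - $\mathbb{C}(J_k\mathbb{C}^n)^{G_k}=\mathbb{C}(\Omega)^W$, where $W=N(\Omega)/Z(\Omega)$ is the Weyl group of the action (not necessarily finite).
   Context: $G_k\subset GL_k(\mathbb{C})$ is the complex algebraic group of all upper triangular $k\times k$ matrices $A(a_1,\dots,a_k)$, $a_1\in\mathbb{C}^*$, $a_2,\dots,a_k\in\mathbb{C}$, with entries $A_{ij}=\sum_{s_1+\cdots+s_i=j,\ s_l\ge 1} a_{s_1}\cdots a_{s_i}$; $\mathfrak{g}_k=\mathrm{Lie}(G_k)$. It corresponds to the group of reparametrizations $t\mapsto a_1t+a_2t^2+\cdots+a_kt^k$ modulo $t^{k+1}$. $J_k\mathbb{C}^n\cong\mathbb{C}^{nk}$ is the space of $k$-jets $(f'(0),\dots,f^{(k)}(0))$ of germs of holomorphic curves $f:(\mathbb{C},0)\to(\mathbb{C}^n,0)$. $G_k$ acts linearly by reparametrization, i.e. by right multiplication of the $n\times k$ matrix $[f'(0),f''(0)/2!,\dots,f^{(k)}(0)/k!]$ by the matrices in $G_k$. For $x\in V=J_k\mathbb{C}^n$, $\mathfrak{g}_{k,x}\subset\mathfrak{g}_k$ is the Lie algebra of the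 stabilizer of $x$ in $G_k$, and $V^{\mathfrak{g}_{k,x}}=\{v\in V\mid \mathfrak{g}_{k,x}.v=0\}$. A point is generic if it lies in an open dense subset of $V$ over which all the stabilizer subalgebras $\mathfrak{g}_{k,y}$ are $G_k$-conjugate. For $\Omega\subset V$, $N(\Omega)=\{g\in G_k\mid g.\Omega\subset\Omega\}$ and $Z(\Omega)=\{g\in G_k\mid g.v=v\ \forall v\in\Omega\}$. $\mathbb{C}(\cdot)$ denotes the field of rational functions; the equality of fields means that restriction of functions to $\Omega$ induces an isomorphism. *)

theory Defs
  imports
    "HOL-Complex_Analysis.Complex_Analysis"
    "HOL-Algebra.Coset"
    "HOL-Algebra.QuotRing"
    "Jordan_Normal_Form.Matrix"
begin

section \<open>Jets and the reparametrization group\<close>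

text \<open>
  Matrices are indexed from 0: the entry \<open>(i, j)\<close> below is the entry \<open>(i + 1, j + 1)\<close> of the
  usual notation. A k-jet \<open>(f'(0), \<dots>, f\<^sup>(\<^sup>k\<^sup>)(0))\<close> is the \<open>n \<times> k\<close> matrix whose columns are
  these derivatives, without dividing by factorials.
\<close>

definition jet :: "nat \<Rightarrow> nat \<Rightarrow> (nat \<Rightarrow> complex \<Rightarrow> complex) \<Rightarrow> complex mat" where
  "jet n k f = mat n k (\<lambda>(i, j). (deriv ^^ (j + 1)) (f i) 0)"

definition jets :: "nat \<Rightarrow> nat \<Rightarrow> complex mat set" where
  "jets n k = {jet n k f | f. \<forall>i<n. f i analytic_on {0} \<and> f i 0 = 0}"

text \<open>The sum runs over the compositions \<open>s\<close> of \<open>j + 1\<close> into \<open>i + 1\<close> positive parts; it is the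
  coefficient of \<open>t ^ (j + 1)\<close> in \<open>(a 1 * t + \<dots> + a k * t ^ k) ^ (i + 1)\<close>. Only \<open>a 1, \<dots>, a k\<close> occur.\<close>
definition reparam_mat :: "nat \<Rightarrow> (nat \<Rightarrow> complex) \<Rightarrow> complex mat" where
  "reparam_mat k a = mat k k (\<lambda>(i, j).
     \<Sum>s\<in>{s. length s = i + 1 \<and> sum_list s = j + 1 \<and> (\<forall>l\<in>set s. 1 \<le> l)}. prod_list (map a s))"

definition reparam_group :: "nat \<Rightarrow> complex mat monoid" where
  "reparam_group k =
     \<lparr>carrier = {reparam_mat k a | a. a 1 \<noteq> 0}, mult = (*), one = 1\<^sub>m k\<rparr>"

text \<open>The matrix \<open>[f'(0), f''(0)/2!, \<dots>, f\<^sup>(\<^sup>k\<^sup>)(0)/k!]\<close> of a jet, and its inverse operation.\<close>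
definition taylor_mat :: "complex mat \<Rightarrow> complex mat" where
  "taylor_mat v = mat (dim_row v) (dim_col v) (\<lambda>(i, j). v $$ (i, j) / fact (j + 1))"

definition jet_of_taylor :: "complex mat \<Rightarrow> complex mat" where
  "jet_of_taylor m = mat (dim_row m) (dim_col m) (\<lambda>(i, j). fact (j + 1) * m $$ (i, j))"

definition jet_act :: "complex mat \<Rightarrow> complex mat \<Rightarrow> complex mat" where
  "jet_act g v = jet_of_taylor (taylor_mat v * g)"

text \<open>The action is the restriction to the group of a map that is linear in \<open>g\<close>, so the derived
  action of the Lie algebra, \<open>d/dt (1 + t X).v\<close> at \<open>t = 0\<close>, is given by the same formula.\<close>
definition lie_act :: "complex mat \<Rightarrow> complex mat \<Rightarrow> complex mat" where
  "lie_act X v = jet_of_taylor (taylor_mat v * X)"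

lemma jets_eq_carrier_mat: "jets n k = carrier_mat n k"
proof
  show "jets n k \<subseteq> carrier_mat n k"
    by (auto simp: jets_def jet_def)
next
  show "carrier_mat n k \<subseteq> jets n k"
  proof
    fix v :: "complex mat"
    assume v: "v \<in> carrier_mat n k"
    define c where "c = (\<lambda>i j. if 1 \<le> j \<and> j \<le> k then v $$ (i, j - 1) / fact j else 0)"
    define f where "f = (\<lambda>i t. \<Sum>j\<le>k. c i j * t ^ j)"
    have an: "f i analytic_on {0}" for i
      unfolding f_def by (intro analytic_intros)
    have c0: "c i 0 = 0" for i by (simp add: c_def)
    have f0: "f i 0 = 0" for i
      unfolding f_def by (intro sum.neutral) (auto simp: c0 power_0_left)
    have exp: "f i has_fps_expansion (\<Sum>j\<le>k. fps_const (c i j) * fps_X ^ j)" for i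
      unfolding f_def by (intro fps_expansion_intros)
    have "fps_nth (\<Sum>j\<le>k. fps_const (c i j) * fps_X ^ j) m = c i m" for i m
      by (simp add: fps_sum_nth if_distrib cong: if_cong) (auto simp: c_def)
    then have nth: "(deriv ^^ m) (f i) 0 = fact m * c i m" for i m
      using fps_nth_fps_expansion[OF exp] by (simp add: field_simps)
    have "v = jet n k f"
      using v by (intro eq_matI) (auto simp: jet_def nth c_def simp del: funpow.simps fact_Suc)
    then show "v \<in> jets n k"
      unfolding jets_def using an f0 by blast
  qed
qed

lemma fps_power_nth_compositions:
  fixes P :: "complex fps"
  assumes "fps_nth P 0 = 0" "0 < l"
  shows "fps_nth (P ^ l) m =
    (\<Sum>s\<in>{s. length s = l \<and> sum_list s = m \<and> (\<forall>r\<in>set s. 1 \<le> r)}. prod_list (map (fps_nth P) s))"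
proof -
  have eq: "(\<Prod>j = 0..l - 1. fps_nth P (s ! j)) = prod_list (map (fps_nth P) s)"
    if "s \<in> natpermute m l" for s
  proof -
    have "{0..l - 1} = {0..<l}" using assms(2) by auto
    then show ?thesis
      using that by (simp add: natpermute_def prod.list_conv_set_nth)
  qed
  have "fps_nth (P ^ l) m = (\<Sum>s\<in>natpermute m l. prod_list (map (fps_nth P) s))"
    using assms(2) eq by (simp add: fps_power_nth)
  also have "\<dots> = (\<Sum>s\<in>{s. length s = l \<and> sum_list s = m \<and> (\<forall>r\<in>set s. 1 \<le> r)}.
      prod_list (map (fps_nth P) s))"
  proof (rule sum.mono_neutral_right)
    show "finite (natpermute m l)" by (rule natpermute_finite)
    show "\<forall>s\<in>natpermute m l - {s. length s = l \<and> sum_list s = m \<and> (\<forall>r\<in>set s. 1 \<le> r)}.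
        prod_list (map (fps_nth P) s) = 0"
    proof
      fix s assume "s \<in> natpermute m l - {s. length s = l \<and> sum_list s = m \<and> (\<forall>r\<in>set s. 1 \<le> r)}"
      then have "\<exists>r\<in>set s. r = 0" by (auto simp: natpermute_def not_le)
      then show "prod_list (map (fps_nth P) s) = 0"
        using assms(1) by (force simp: prod_list_zero_iff)
    qed
  qed (auto simp: natpermute_def)
  finally show ?thesis .
qed

lemma jet_compose:
  assumes f: "\<forall>i<n. f i analytic_on {0} \<and> f i 0 = 0"
    and \<phi>: "\<phi> analytic_on {0}" "\<phi> 0 = 0"
  shows "jet n k (\<lambda>i t. f i (\<phi> t)) =
    jet_act (reparam_mat k (\<lambda>j. (deriv ^^ j) \<phi> 0 / fact j)) (jet n k f)"
proof (rule eq_matI)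
  define P where "P = fps_expansion \<phi> 0"
  have P: "\<phi> has_fps_expansion P"
    unfolding P_def by (rule analytic_at_imp_has_fps_expansion_0[OF \<phi>(1)])
  have Pnth: "(\<lambda>j. (deriv ^^ j) \<phi> 0 / fact j) = fps_nth P"
    using fps_nth_fps_expansion[OF P] by auto
  have P0: "fps_nth P 0 = 0"
    using fps_nth_fps_expansion[OF P, of 0] \<phi>(2) by simp
  fix i j
  let ?A = "reparam_mat k (\<lambda>j. (deriv ^^ j) \<phi> 0 / fact j)"
  assume "i < dim_row (jet_act ?A (jet n k f))" "j < dim_col (jet_act ?A (jet n k f))"
  then have ij: "i < n" "j < k"
    by (auto simp: jet_act_def jet_of_taylor_def taylor_mat_def jet_def reparam_mat_def)
  define F where "F = fps_expansion (f i) 0"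
  have F: "f i has_fps_expansion F"
    unfolding F_def using f ij by (intro analytic_at_imp_has_fps_expansion_0) auto
  have F0: "fps_nth F 0 = 0"
    using fps_nth_fps_expansion[OF F, of 0] f ij by simp
  have A: "?A $$ (l, j) = fps_nth (P ^ (l + 1)) (j + 1)" if "l < k" for l
    using that ij by (subst fps_power_nth_compositions[OF P0]) (simp_all add: reparam_mat_def Pnth)
  have "(f i \<circ> \<phi>) has_fps_expansion (F oo P)"
    by (rule has_fps_expansion_compose[OF F P P0])
  from fps_nth_fps_expansion[OF this, of "j + 1"]
  have "(deriv ^^ (j + 1)) (\<lambda>t. f i (\<phi> t)) 0 = fact (j + 1) * fps_nth (F oo P) (j + 1)"
    by (simp add: o_def del: funpow.simps fact_Suc)
  also have "fps_nth (F oo P) (j + 1) = (\<Sum>l=0..j + 1. fps_nth F l * fps_nth (P ^ l) (j + 1))"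
    by (simp add: fps_compose_nth)
  also have "\<dots> = (\<Sum>l=0..k. fps_nth F l * fps_nth (P ^ l) (j + 1))"
    using ij P0 by (intro sum.mono_neutral_left) (auto simp: startsby_zero_power_prefix)
  also have "\<dots> = (\<Sum>l=1..k. fps_nth F l * fps_nth (P ^ l) (j + 1))"
    by (simp add: sum.atLeast_Suc_atMost F0)
  also have "\<dots> = (\<Sum>l=0..<k. fps_nth F (l + 1) * fps_nth (P ^ (l + 1)) (j + 1))"
    by (rule sum.reindex_bij_witness[of _ "\<lambda>l. l + 1" "\<lambda>l. l - 1"]) auto
  also have "\<dots> = (\<Sum>l=0..<k. (deriv ^^ (l + 1)) (f i) 0 / fact (l + 1) * ?A $$ (l, j))"
    by (intro sum.cong) (simp_all only: A fps_nth_fps_expansion[OF F] atLeastLessThan_iff)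
  finally show "jet n k (\<lambda>i t. f i (\<phi> t)) $$ (i, j) = jet_act ?A (jet n k f) $$ (i, j)"
    using ij by (simp add: jet_act_def jet_of_taylor_def taylor_mat_def jet_def scalar_prod_def
        reparam_mat_def)
qed (auto simp: jet_act_def jet_of_taylor_def taylor_mat_def jet_def reparam_mat_def)

section \<open>Polynomial functions, Zariski topology, Lie algebras\<close>

inductive_set poly_funs :: "nat \<Rightarrow> nat \<Rightarrow> (complex mat \<Rightarrow> complex) set" for n k where
  const: "(\<lambda>_. c) \<in> poly_funs n k"
| coord: "i < n \<Longrightarrow> j < k \<Longrightarrow> (\<lambda>v. v $$ (i, j)) \<in> poly_funs n k"
| add: "p \<in> poly_funs n k \<Longrightarrow> q \<in> poly_funs n k \<Longrightarrow> (\<lambda>v. p v + q v) \<in> poly_funs n k"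
| mult: "p \<in> poly_funs n k \<Longrightarrow> q \<in> poly_funs n k \<Longrightarrow> (\<lambda>v. p v * q v) \<in> poly_funs n k"

definition zariski :: "nat \<Rightarrow> nat \<Rightarrow> complex mat set \<Rightarrow> complex mat topology" where
  "zariski n k X = topology_generated_by {{v \<in> X. p v \<noteq> 0} | p. p \<in> poly_funs n k}"

text \<open>The Lie algebra of a Zariski-closed subgroup of the group of invertible \<open>k \<times> k\<close> matrices, as
  its Zariski tangent space at the identity: the matrices along which the differential at the
  identity of every polynomial vanishing on the subgroup is zero.\<close>
definition lie_algebra :: "nat \<Rightarrow> complex mat set \<Rightarrow> complex mat set" where
  "lie_algebra k H = {X \<in> carrier_mat k k.
     \<forall>p\<in>poly_funs k k. (\<forall>h\<in>H. p h = 0) \<longrightarrow>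
       ((\<lambda>t. p (1\<^sub>m k + t \<cdot>\<^sub>m X)) has_field_derivative 0) (at 0)}"

definition stabilizer :: "nat \<Rightarrow> complex mat \<Rightarrow> complex mat set" where
  "stabilizer k x = {g \<in> carrier (reparam_group k). jet_act g x = x}"

definition stab_lie :: "nat \<Rightarrow> complex mat \<Rightarrow> complex mat set" where
  "stab_lie k x = lie_algebra k (stabilizer k x)"

definition lie_fixed :: "nat \<Rightarrow> nat \<Rightarrow> complex mat set \<Rightarrow> complex mat set" where
  "lie_fixed n k \<hh> = {v \<in> jets n k. \<forall>X\<in>\<hh>. lie_act X v = 0\<^sub>m n k}"

definition conjugate_subalgebras :: "nat \<Rightarrow> complex mat set \<Rightarrow> complex mat set \<Rightarrow> bool" where
  "conjugate_subalgebras k \<hh> \<hh>' \<longleftrightarrow>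
     (\<exists>g\<in>carrier (reparam_group k). \<hh>' = (\<lambda>X. g * X * inv\<^bsub>reparam_group k\<^esub> g) ` \<hh>)"

definition generic :: "nat \<Rightarrow> nat \<Rightarrow> complex mat \<Rightarrow> bool" where
  "generic n k x \<longleftrightarrow>
     (\<exists>U. openin (zariski n k (jets n k)) U \<and> zariski n k (jets n k) closure_of U = jets n k \<and>
        (\<forall>y\<in>U. \<forall>z\<in>U. conjugate_subalgebras k (stab_lie k y) (stab_lie k z)) \<and> x \<in> U)"

section \<open>Weyl group\<close>

definition weyl_N :: "nat \<Rightarrow> complex mat set \<Rightarrow> complex mat set" where
  "weyl_N k \<Omega> = {g \<in> carrier (reparam_group k). jet_act g ` \<Omega> \<subseteq> \<Omega>}"

definition weyl_Z :: "nat \<Rightarrow> complex mat set \<Rightarrow> complex mat set" where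
  "weyl_Z k \<Omega> = {g \<in> carrier (reparam_group k). \<forall>v\<in>\<Omega>. jet_act g v = v}"

definition weyl_group :: "nat \<Rightarrow> complex mat set \<Rightarrow> complex mat set monoid" where
  "weyl_group k \<Omega> = ((reparam_group k)\<lparr>carrier := weyl_N k \<Omega>\<rparr>) Mod weyl_Z k \<Omega>"

text \<open>For \<open>v \<in> \<Omega>\<close> all elements of a coset \<open>w\<close> move \<open>v\<close> to the same point.\<close>
definition weyl_act :: "complex mat set \<Rightarrow> complex mat \<Rightarrow> complex mat" where
  "weyl_act w v = the_elem ((\<lambda>g. jet_act g v) ` w)"

section \<open>Rational functions\<close>

text \<open>Field of fractions of an integral domain \<open>R\<close>, as classes of pairs (numerator, denominator).
  The set \<open>fraction R a b\<close> is empty when \<open>b\<close> is zero.\<close>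

definition frac_pairs :: "('a, 'm) ring_scheme \<Rightarrow> ('a \<times> 'a) set" where
  "frac_pairs R = carrier R \<times> (carrier R - {\<zero>\<^bsub>R\<^esub>})"

definition frac_rel :: "('a, 'm) ring_scheme \<Rightarrow> (('a \<times> 'a) \<times> ('a \<times> 'a)) set" where
  "frac_rel R = {((a, b), (c, d)). (a, b) \<in> frac_pairs R \<and> (c, d) \<in> frac_pairs R \<and>
     a \<otimes>\<^bsub>R\<^esub> d = c \<otimes>\<^bsub>R\<^esub> b}"

definition fraction :: "('a, 'm) ring_scheme \<Rightarrow> 'a \<Rightarrow> 'a \<Rightarrow> ('a \<times> 'a) set" where
  "fraction R a b = frac_rel R `` {(a, b)}"

definition fraction_field :: "('a, 'm) ring_scheme \<Rightarrow> ('a \<times> 'a) set ring" where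
  "fraction_field R =
     \<lparr>carrier = frac_pairs R // frac_rel R,
      mult = (\<lambda>F G. \<Union>(a, b)\<in>F. \<Union>(c, d)\<in>G. fraction R (a \<otimes>\<^bsub>R\<^esub> c) (b \<otimes>\<^bsub>R\<^esub> d)),
      one = fraction R \<one>\<^bsub>R\<^esub> \<one>\<^bsub>R\<^esub>,
      zero = fraction R \<zero>\<^bsub>R\<^esub> \<one>\<^bsub>R\<^esub>,
      add = (\<lambda>F G. \<Union>(a, b)\<in>F. \<Union>(c, d)\<in>G.
        fraction R ((a \<otimes>\<^bsub>R\<^esub> d) \<oplus>\<^bsub>R\<^esub> (c \<otimes>\<^bsub>R\<^esub> b)) (b \<otimes>\<^bsub>R\<^esub> d))\<rparr>"

text \<open>The ring of polynomial functions on a set \<open>X\<close> of \<open>n \<times> k\<close> matrices; a domain when \<open>X\<close> is a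
  linear subspace.\<close>
definition coord_ring :: "nat \<Rightarrow> nat \<Rightarrow> complex mat set \<Rightarrow> (complex mat \<Rightarrow> complex) ring" where
  "coord_ring n k X =
     \<lparr>carrier = (\<lambda>p. restrict p X) ` poly_funs n k,
      mult = (\<lambda>p q. \<lambda>v\<in>X. p v * q v),
      one = (\<lambda>v\<in>X. 1),
      zero = (\<lambda>v\<in>X. 0),
      add = (\<lambda>p q. \<lambda>v\<in>X. p v + q v)\<rparr>"

definition rational_functions ::
    "nat \<Rightarrow> nat \<Rightarrow> complex mat set \<Rightarrow> ((complex mat \<Rightarrow> complex) \<times> (complex mat \<Rightarrow> complex)) set ring" where
  "rational_functions n k X = fraction_field (coord_ring n k X)"

definition pullback ::
    "nat \<Rightarrow> nat \<Rightarrow> complex mat set \<Rightarrow> (complex mat \<Rightarrow> complex mat) \<Rightarrow>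
     ((complex mat \<Rightarrow> complex) \<times> (complex mat \<Rightarrow> complex)) set \<Rightarrow>
     ((complex mat \<Rightarrow> complex) \<times> (complex mat \<Rightarrow> complex)) set" where
  "pullback n k X \<phi> F =
     (\<Union>(p, q)\<in>F. fraction (coord_ring n k X) (\<lambda>v\<in>X. p (\<phi> v)) (\<lambda>v\<in>X. q (\<phi> v)))"

text \<open>The field of rational functions on \<open>X\<close> invariant under a set \<open>\<Gamma>\<close> acting on \<open>X\<close> through \<open>\<alpha>\<close>.\<close>
definition invariant_functions ::
    "nat \<Rightarrow> nat \<Rightarrow> complex mat set \<Rightarrow> 'g set \<Rightarrow> ('g \<Rightarrow> complex mat \<Rightarrow> complex mat) \<Rightarrow>
     ((complex mat \<Rightarrow> complex) \<times> (complex mat \<Rightarrow> complex)) set ring" where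
  "invariant_functions n k X \<Gamma> \<alpha> =
     (rational_functions n k X)\<lparr>carrier :=
        {F \<in> carrier (rational_functions n k X). \<forall>g\<in>\<Gamma>. pullback n k X (\<alpha> g) F = F}\<rparr>"

text \<open>Restriction of a rational function to a subset \<open>Y\<close>. Representatives whose denominator vanishes
  identically on \<open>Y\<close> contribute nothing to the union; if all of them are of this kind, the
  restriction is undefined and the result is the empty set, which is not an element of
  \<open>carrier (rational_functions n k Y)\<close>.\<close>
definition restrict_function ::
    "nat \<Rightarrow> nat \<Rightarrow> complex mat set \<Rightarrow>
     ((complex mat \<Rightarrow> complex) \<times> (complex mat \<Rightarrow> complex)) set \<Rightarrow>
     ((complex mat \<Rightarrow> complex) \<times> (complex mat \<Rightarrow> complex)) set" where
  "restrict_function n k Y F =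
     (\<Union>(p, q)\<in>F. fraction (coord_ring n k Y) (restrict p Y) (restrict q Y))"

end

theory Submission
  imports Defs
begin

text \<open>
  A jet with nonzero first derivative has trivial stabilizer: comparing the coefficients of
  \<open>f \<circ> \<phi>\<close> and \<open>f\<close> one degree at a time forces \<open>\<phi>(t) = t\<close>. Such jets form a nonempty open set, which
  meets every dense set, so the stabilizer subalgebra of every generic point is conjugate to zero,
  hence zero. Therefore \<open>\<Omega>\<close> is the whole jet space, \<open>Z(\<Omega>)\<close> is trivial, the Weyl group is \<open>G\<^sub>k\<close>
  itself, and restriction to \<open>\<Omega>\<close> is the identity.
\<close>

section \<open>Stabilizers of regular jets\<close>

text \<open>A composition with a part other than 1 contributes a factor 0, and the composition into
  ones exists only when \<open>i = j\<close>. The hypothesis concerns only the parts that occur in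
  this one entry, so the lemma applies while only some coefficients of \<open>a\<close> are
  known.\<close>

lemma reparam_mat_entry_of_identity:
  assumes ij: "i < k" "j < k"
    and a: "\<And>s l. length s = i + 1 \<Longrightarrow> sum_list s = j + 1 \<Longrightarrow> \<forall>r\<in>set s. 1 \<le> r \<Longrightarrow> l \<in> set s
      \<Longrightarrow> a l = (if l = 1 then 1 else 0)"
  shows "reparam_mat k a $$ (i, j) = (if i = j then 1 else 0)"
proof -
  let ?S = "{s. length s = i + 1 \<and> sum_list s = j + 1 \<and> (\<forall>l\<in>set s. 1 \<le> l)}"
  let ?r = "replicate (i + 1) (1::nat)"
  have fin: "finite ?S"
    by (rule finite_subset[OF _ natpermute_finite[of "j + 1" "i + 1"]]) (auto simp: natpermute_def)
  have term_eq: "prod_list (map a s) = (if s = ?r then 1 else 0)" if s: "s \<in> ?S" for s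
  proof (cases "s = ?r")
    case True
    have "a 1 = 1" using a[of s 1] s True by auto
    then show ?thesis using True by (simp add: prod_list_replicate map_replicate del: replicate_Suc)
  next
    case False
    have "\<exists>l\<in>set s. l \<noteq> 1"
    proof (rule ccontr)
      assume "\<not> ?thesis"
      then have "s = replicate (length s) 1" by (intro replicate_eqI) auto
      then show False using False s by simp
    qed
    then obtain l where l: "l \<in> set s" "l \<noteq> 1" by blast
    then have "a l = 0" using a[of s l] s by auto
    then show ?thesis using False l by (force simp: prod_list_zero_iff)
  qed
  have "reparam_mat k a $$ (i, j) = (\<Sum>s\<in>?S. prod_list (map a s))"
    using ij by (simp add: reparam_mat_def)
  also have "\<dots> = (\<Sum>s\<in>?S. if s = ?r then 1 else 0)"
    by (intro sum.cong refl term_eq)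
  also have "\<dots> = (if ?r \<in> ?S then 1 else 0)"
    using fin by (rule sum.delta)
  also have "?r \<in> ?S \<longleftrightarrow> i = j" by (auto simp: sum_list_replicate)
  finally show ?thesis .
qed

lemma reparam_mat_eq_one:
  assumes "\<And>l. 1 \<le> l \<Longrightarrow> l \<le> k \<Longrightarrow> a l = (if l = 1 then 1 else 0)"
  shows "reparam_mat k a = 1\<^sub>m k"
proof (rule eq_matI)
  fix i j assume "i < dim_row (1\<^sub>m k)" "j < dim_col (1\<^sub>m k)"
  then have ij: "i < k" "j < k" by auto
  have "reparam_mat k a $$ (i, j) = (if i = j then 1 else 0)"
  proof (rule reparam_mat_entry_of_identity[OF ij])
    fix s l assume s: "sum_list s = j + 1" "\<forall>r\<in>set s. 1 \<le> r" "l \<in> set s"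
    then have "l \<le> j + 1" using member_le_sum_list[of l s] by auto
    then show "a l = (if l = 1 then 1 else 0)" using assms[of l] s ij by auto
  qed
  then show "reparam_mat k a $$ (i, j) = 1\<^sub>m k $$ (i, j)" using ij by simp
qed (auto simp: reparam_mat_def)

lemma one_in_reparam_group: "1\<^sub>m k \<in> carrier (reparam_group k)"
proof -
  let ?a = "\<lambda>l::nat. if l = 1 then 1 else 0 :: complex"
  have "1\<^sub>m k = reparam_mat k ?a" "?a 1 \<noteq> 0" by (simp_all add: reparam_mat_eq_one)
  then show ?thesis unfolding reparam_group_def by auto
qed

lemma reparam_group_carrier_mat: "g \<in> carrier (reparam_group k) \<Longrightarrow> g \<in> carrier_mat k k"
  by (auto simp: reparam_group_def reparam_mat_def)

lemma jet_act_carrier_mat: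
  "g \<in> carrier_mat k k \<Longrightarrow> v \<in> carrier_mat n k \<Longrightarrow> jet_act g v \<in> carrier_mat n k"
  by (auto simp: jet_act_def jet_of_taylor_def taylor_mat_def)

lemma jet_act_entry:
  assumes "g \<in> carrier_mat k k" "v \<in> carrier_mat n k" "i < n" "j < k"
  shows "jet_act g v $$ (i, j) =
    fact (j + 1) * (\<Sum>l<k. v $$ (i, l) / fact (l + 1) * g $$ (l, j))"
  using assms
  by (simp add: jet_act_def jet_of_taylor_def taylor_mat_def scalar_prod_def lessThan_atLeast0
      del: fact_Suc)

lemma jet_act_one: "v \<in> carrier_mat n k \<Longrightarrow> jet_act (1\<^sub>m k) v = v"
  by (rule eq_matI)
    (auto simp: jet_act_def jet_of_taylor_def taylor_mat_def simp del: fact_Suc)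

lemma reparam_mat_first_row: "j < k \<Longrightarrow> reparam_mat k a $$ (0, j) = a (j + 1)"
proof -
  assume j: "j < k"
  have "{s. length s = 0 + 1 \<and> sum_list s = j + 1 \<and> (\<forall>l\<in>set s. 1 \<le> l)} = {[j + 1]}"
    by (auto simp: length_Suc_conv)
  then show ?thesis using j by (simp add: reparam_mat_def)
qed

text \<open>Column \<open>j\<close> of the fixed-point equation, read in row 0, contains one
  unknown, \<open>a (j + 1)\<close>, multiplied by the nonzero number \<open>v $$ (0, 0)\<close>.
  The coefficients are therefore determined one after another.\<close>

lemma stabilizer_regular:
  assumes v: "v \<in> carrier_mat n k" and pos: "0 < n" "0 < k" and reg: "v $$ (0, 0) \<noteq> 0"
  shows "stabilizer k v = {1\<^sub>m k}"
proof
  show "{1\<^sub>m k} \<subseteq> stabilizer k v"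
    using one_in_reparam_group jet_act_one[OF v] by (simp add: stabilizer_def)
  show "stabilizer k v \<subseteq> {1\<^sub>m k}"
  proof
    fix g assume "g \<in> stabilizer k v"
    then have gc: "g \<in> carrier (reparam_group k)" and fixed: "jet_act g v = v"
      by (auto simp: stabilizer_def)
    obtain a where g: "g = reparam_mat k a" using gc by (auto simp: reparam_group_def)
    have "m \<le> k \<Longrightarrow> \<forall>l. 1 \<le> l \<and> l \<le> m \<longrightarrow> a l = (if l = 1 then 1 else 0)" for m
    proof (induction m)
      case (Suc j)
      then have j: "j < k" and IH: "\<And>l. 1 \<le> l \<Longrightarrow> l \<le> j \<Longrightarrow> a l = (if l = 1 then 1 else 0)" by auto
      \<comment> \<open>Below row 0 the compositions have at least two positive parts, so each part
        is at most \<open>j\<close> and the induction hypothesis covers it.\<close>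
      have entry: "g $$ (l, j) = (if l = j then 1 else 0)" if l: "0 < l" "l < k" for l
        unfolding g
      proof (rule reparam_mat_entry_of_identity[OF l(2) j])
        fix s r
        assume s: "length s = l + 1" "sum_list s = j + 1" "\<forall>r\<in>set s. 1 \<le> r" "r \<in> set s"
        obtain ys zs where s_eq: "s = ys @ r # zs" using s(4) by (meson split_list)
        have "set (ys @ zs) \<noteq> {}" using s(1) l s_eq by auto
        then obtain r' where r': "r' \<in> set (ys @ zs)" by (meson ex_in_conv)
        then have "1 \<le> sum_list (ys @ zs)"
          using s(3) s_eq member_le_sum_list[of r' "ys @ zs"] by (auto dest: order_trans)
        then have "r \<le> j" using s(2) s_eq by simp
        then show "a r = (if r = 1 then 1 else 0)" using IH s by auto
      qed
      \<comment> \<open>The term \<open>l = 0\<close> carries \<open>a (j + 1)\<close>. Among the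
        others only the diagonal term \<open>l = j\<close> survives; for \<open>j > 0\<close> it
        cancels the right-hand side, and for \<open>j = 0\<close> it is the term
        \<open>l = 0\<close> itself.\<close>
      let ?f = "\<lambda>l. v $$ (0, l) / fact (l + 1) * g $$ (l, j)"
      have "fact (j + 1) * (\<Sum>l<k. ?f l) = v $$ (0, j)"
        using jet_act_entry[OF reparam_group_carrier_mat[OF gc] v pos(1) j] fixed by simp
      then have "(\<Sum>l<k. ?f l) = v $$ (0, j) / fact (j + 1)"
        by (subst eq_divide_eq) (simp only: mult.commute fact_nonzero not_False_eq_True if_True)
      moreover have "(\<Sum>l<k. ?f l) = ?f 0 + (\<Sum>l\<in>{..<k} - {0}. ?f l)"
        using pos by (intro sum.remove) auto
      moreover have "?f 0 = v $$ (0, 0) * a (j + 1)"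
        using reparam_mat_first_row[OF j] g by simp
      moreover have "(\<Sum>l\<in>{..<k} - {0}. ?f l) =
          (\<Sum>l\<in>{..<k} - {0}. if l = j then v $$ (0, j) / fact (j + 1) else 0)"
        by (intro sum.cong) (auto simp: entry simp del: fact_Suc)
      moreover have "\<dots> = (if j = 0 then 0 else v $$ (0, j) / fact (j + 1))"
        using j by simp
      ultimately have "v $$ (0, 0) * a (j + 1) = (if j = 0 then v $$ (0, 0) else 0)"
        by (auto split: if_splits)
      then have "a (j + 1) = (if j = 0 then 1 else 0)" using reg by (auto split: if_splits)
      then show ?case using IH by (auto simp: le_Suc_eq split: if_splits)
    qed auto
    then have "g = 1\<^sub>m k" unfolding g by (intro reparam_mat_eq_one) blast
    then show "g \<in> {1\<^sub>m k}" by simp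
  qed
qed

section \<open>The generic stabilizer subalgebra\<close>

lemma zero_in_lie_algebra: "0\<^sub>m k k \<in> lie_algebra k H"
proof -
  have "1\<^sub>m k + t \<cdot>\<^sub>m 0\<^sub>m k k = 1\<^sub>m k" for t :: complex by auto
  then show ?thesis by (simp add: lie_algebra_def)
qed

text \<open>Each coordinate function, shifted to vanish at the identity, has the corresponding entry
  of \<open>X\<close> as its derivative along \<open>X\<close>.\<close>

lemma lie_algebra_trivial: "lie_algebra k {1\<^sub>m k} = {0\<^sub>m k k}"
proof
  show "{0\<^sub>m k k} \<subseteq> lie_algebra k {1\<^sub>m k}" using zero_in_lie_algebra by blast
  show "lie_algebra k {1\<^sub>m k} \<subseteq> {0\<^sub>m k k}"
  proof
    fix X assume X: "X \<in> lie_algebra k {1\<^sub>m k}"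
    then have Xc: "X \<in> carrier_mat k k" by (simp add: lie_algebra_def)
    have "X $$ (i, j) = 0" if ij: "i < k" "j < k" for i j
    proof -
      let ?p = "\<lambda>v::complex mat. v $$ (i, j) + - (1\<^sub>m k $$ (i, j))"
      have "?p \<in> poly_funs k k"
        using ij by (intro poly_funs.add poly_funs.coord poly_funs.const)
      then have "((\<lambda>t. ?p (1\<^sub>m k + t \<cdot>\<^sub>m X)) has_field_derivative 0) (at 0)"
        using X unfolding lie_algebra_def by fastforce
      moreover have "(\<lambda>t. ?p (1\<^sub>m k + t \<cdot>\<^sub>m X)) = (\<lambda>t. t * X $$ (i, j))"
        using ij Xc by (auto simp: fun_eq_iff)
      moreover have "((\<lambda>t. t * X $$ (i, j)) has_field_derivative X $$ (i, j)) (at 0)"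
        by (auto intro!: derivative_eq_intros)
      ultimately show ?thesis using DERIV_unique by fastforce
    qed
    then show "X \<in> {0\<^sub>m k k}" using Xc by (auto intro!: eq_matI)
  qed
qed

lemma openin_zariski_basic:
  "p \<in> poly_funs n k \<Longrightarrow> openin (zariski n k X) {v \<in> X. p v \<noteq> 0}"
  unfolding zariski_def by (rule topology_generated_by_Basis) blast

lemma topspace_zariski: "topspace (zariski n k X) = X"
proof -
  have "(\<lambda>_. 1) \<in> poly_funs n k" by (rule poly_funs.const)
  then have "{v \<in> X. (1::complex) \<noteq> 0} \<subseteq> \<Union> {{v \<in> X. p v \<noteq> 0} | p. p \<in> poly_funs n k}" by blast
  then show ?thesis unfolding zariski_def topology_generated_by_topspace by auto
qed

lemma stab_lie_generic:
  assumes "0 < k" "0 < n" "generic n k x"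
  shows "stab_lie k x = {0\<^sub>m k k}"
proof -
  obtain U where dense: "zariski n k (jets n k) closure_of U = jets n k"
    and conj: "\<forall>y\<in>U. \<forall>z\<in>U. conjugate_subalgebras k (stab_lie k y) (stab_lie k z)"
    and xU: "x \<in> U"
    using assms(3) by (auto simp: generic_def)
  let ?R = "{v \<in> jets n k. v $$ (0, 0) \<noteq> 0}"
  \<comment> \<open>This matrix witnesses that the open set \<open>?R\<close> is nonempty. It lies
    in the closure of \<open>U\<close>, so \<open>?R\<close> meets \<open>U\<close>.\<close>
  let ?v = "mat n k (\<lambda>_. 1 :: complex)"
  have "openin (zariski n k (jets n k)) ?R"
    using assms by (intro openin_zariski_basic poly_funs.coord)
  moreover have "?v \<in> ?R" using assms by (simp add: jets_eq_carrier_mat)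
  moreover have "?v \<in> zariski n k (jets n k) closure_of U"
    unfolding dense by (simp add: jets_eq_carrier_mat)
  ultimately obtain y where y: "y \<in> U" "y \<in> ?R" unfolding in_closure_of by meson
  have "stab_lie k y = {0\<^sub>m k k}"
    unfolding stab_lie_def using y assms stabilizer_regular[of y n k] lie_algebra_trivial
    by (simp add: jets_eq_carrier_mat)
  moreover have "conjugate_subalgebras k (stab_lie k y) (stab_lie k x)" using conj y xU by blast
  \<comment> \<open>A conjugate of a singleton is a singleton, and membership of zero identifies its
    element. The inverse in the conjugation formula never has to be computed.\<close>
  ultimately obtain Y where "stab_lie k x = {Y}" by (auto simp: conjugate_subalgebras_def)
  moreover have "0\<^sub>m k k \<in> stab_lie k x" unfolding stab_lie_def by (rule zero_in_lie_algebra)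
  ultimately show ?thesis by simp
qed

lemma lie_fixed_zero: "lie_fixed n k {0\<^sub>m k k} = jets n k"
proof -
  have "lie_act (0\<^sub>m k k) v = 0\<^sub>m n k" if "v \<in> carrier_mat n k" for v
    using that by (auto simp: lie_act_def jet_of_taylor_def taylor_mat_def intro!: eq_matI)
  then show ?thesis by (auto simp: lie_fixed_def jets_eq_carrier_mat)
qed

section \<open>The Weyl group of the whole jet space\<close>

lemma weyl_N_jets: "weyl_N k (jets n k) = carrier (reparam_group k)"
  by (auto simp: weyl_N_def jets_eq_carrier_mat
      intro: jet_act_carrier_mat[OF reparam_group_carrier_mat])

text \<open>An element fixing every jet fixes the all-ones jet, whose stabilizer is already
  trivial.\<close>

lemma weyl_Z_jets:
  assumes "0 < k" "0 < n"
  shows "weyl_Z k (jets n k) = {1\<^sub>m k}"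
proof
  let ?v = "mat n k (\<lambda>_. 1 :: complex)"
  have "weyl_Z k (jets n k) \<subseteq> stabilizer k ?v"
    by (auto simp: weyl_Z_def stabilizer_def jets_eq_carrier_mat)
  then show "weyl_Z k (jets n k) \<subseteq> {1\<^sub>m k}"
    using stabilizer_regular[of ?v n k] assms by simp
  show "{1\<^sub>m k} \<subseteq> weyl_Z k (jets n k)"
    using one_in_reparam_group by (auto simp: weyl_Z_def jets_eq_carrier_mat jet_act_one)
qed

lemma carrier_weyl_group_jets:
  assumes "0 < k" "0 < n"
  shows "carrier (weyl_group k (jets n k)) = (\<lambda>g. {g}) ` carrier (reparam_group k)"
proof -
  have mult: "mult (reparam_group k) = (*)" by (simp add: reparam_group_def)
  have "carrier (weyl_group k (jets n k)) = (\<lambda>g. {1\<^sub>m k * g}) ` carrier (reparam_group k)"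
    unfolding weyl_group_def weyl_N_jets weyl_Z_jets[OF assms]
    by (auto simp: FactGroup_def RCOSETS_def r_coset_def mult)
  also have "\<dots> = (\<lambda>g. {g}) ` carrier (reparam_group k)"
    by (intro image_cong) (auto dest: reparam_group_carrier_mat)
  finally show ?thesis .
qed

text \<open>Cosets of the trivial subgroup are singletons \<open>{g}\<close>, and
  \<open>weyl_act {g}\<close> is \<open>jet_act g\<close>, so both invariance conditions define
  literally the same structure.\<close>

lemma invariant_functions_weyl_jets:
  assumes "0 < k" "0 < n"
  shows "invariant_functions n k (jets n k) (carrier (weyl_group k (jets n k))) weyl_act =
    invariant_functions n k (jets n k) (carrier (reparam_group k)) jet_act"
proof -
  have "weyl_act {g} = jet_act g" for g by (auto simp: weyl_act_def)
  then show ?thesis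
    unfolding invariant_functions_def carrier_weyl_group_jets[OF assms] by simp
qed

section \<open>Rational functions on the jet space\<close>

text \<open>Restriction to the line through points where \<open>p\<close> and \<open>q\<close> do not vanish reduces to polynomials
  in one variable.\<close>
lemma poly_funs_no_zero_divisors:
  assumes p: "p \<in> poly_funs n k" and q: "q \<in> poly_funs n k"
    and v: "v \<in> carrier_mat n k" "p v \<noteq> 0" and w: "w \<in> carrier_mat n k" "q w \<noteq> 0"
  shows "\<exists>u\<in>carrier_mat n k. p u * q u \<noteq> 0"
proof -
  \<comment> \<open>The line passes through \<open>v\<close> at \<open>t = 0\<close> and
    \<open>w\<close> at \<open>t = 1\<close>, so neither \<open>p\<close> nor \<open>q\<close>
    vanishes identically along it.\<close>
  define L where "L t = mat n k (\<lambda>ij. v $$ ij + t * (w $$ ij - v $$ ij))" for t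
  have L0: "L 0 = v" and L1: "L 1 = w" using v w by (auto simp: L_def intro!: eq_matI)
  have ex: "\<exists>P. \<forall>t. poly P t = r (L t)" if "r \<in> poly_funs n k" for r
    using that
  proof induction
    case (const c)
    show ?case by (rule exI[of _ "[:c:]"]) simp
  next
    case (coord i j)
    then show ?case
      by (intro exI[of _ "[:v $$ (i, j), w $$ (i, j) - v $$ (i, j):]"]) (simp add: L_def)
  next
    case (add r s)
    then show ?case by (metis poly_add)
  next
    case (mult r s)
    then show ?case by (metis poly_mult)
  qed
  obtain P Q where P: "\<And>t. poly P t = p (L t)" and Q: "\<And>t. poly Q t = q (L t)"
    using ex[OF p] ex[OF q] by blast
  have "P \<noteq> 0" using P[of 0] v L0 by auto
  moreover have "Q \<noteq> 0" using Q[of 1] w L1 by auto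
  ultimately obtain t where "poly (P * Q) t \<noteq> 0"
    using poly_all_0_iff_0[of "P * Q"] by auto
  then have "p (L t) * q (L t) \<noteq> 0" by (simp add: P Q)
  then show ?thesis by (auto simp: L_def)
qed

text \<open>Only transitivity has content: the middle denominator is cancelled by means of
  \<open>poly_funs_no_zero_divisors\<close>.\<close>

lemma equiv_frac_rel_jets:
  "equiv (frac_pairs (coord_ring n k (jets n k))) (frac_rel (coord_ring n k (jets n k)))"
proof -
  let ?R = "coord_ring n k (jets n k)" and ?V = "carrier_mat n k :: complex mat set"
  have rel: "((a, b), (c, d)) \<in> frac_rel ?R \<longleftrightarrow>
      (a, b) \<in> frac_pairs ?R \<and> (c, d) \<in> frac_pairs ?R \<and> (\<forall>v\<in>?V. a v * d v = c v * b v)"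
    for a b c d
    by (auto simp: frac_rel_def coord_ring_def jets_eq_carrier_mat restrict_def fun_eq_iff)
  have num: "\<exists>p\<in>poly_funs n k. \<forall>v\<in>?V. a v = p v" if "(a, b) \<in> frac_pairs ?R" for a b
    using that by (auto simp: frac_pairs_def coord_ring_def jets_eq_carrier_mat)
  have den: "\<exists>p\<in>poly_funs n k. (\<forall>v\<in>?V. b v = p v) \<and> (\<exists>v\<in>?V. p v \<noteq> 0)"
    if "(a, b) \<in> frac_pairs ?R" for a b
    using that by (fastforce simp: frac_pairs_def coord_ring_def jets_eq_carrier_mat restrict_def)
  show ?thesis
  proof (rule equivI)
    show "frac_rel ?R \<subseteq> frac_pairs ?R \<times> frac_pairs ?R" by (auto simp: frac_rel_def)
    show "refl_on (frac_pairs ?R) (frac_rel ?R)"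
      by (auto simp: refl_on_def frac_rel_def)
    show "sym (frac_rel ?R)" by (auto simp: sym_def frac_rel_def)
    show "trans (frac_rel ?R)"
    proof (rule transI, clarify)
      fix a b c d e f
      assume 1: "((a, b), (c, d)) \<in> frac_rel ?R" and 2: "((c, d), (e, f)) \<in> frac_rel ?R"
      have pairs: "(a, b) \<in> frac_pairs ?R" "(c, d) \<in> frac_pairs ?R" "(e, f) \<in> frac_pairs ?R"
        using 1 2 unfolding rel by auto
      obtain pa where pa: "pa \<in> poly_funs n k" "\<forall>v\<in>?V. a v = pa v"
        using num[OF pairs(1)] by blast
      obtain pb where pb: "pb \<in> poly_funs n k" "\<forall>v\<in>?V. b v = pb v"
        using den[OF pairs(1)] by blast
      obtain pd where pd: "pd \<in> poly_funs n k" "\<forall>v\<in>?V. d v = pd v" and nz: "\<exists>v\<in>?V. pd v \<noteq> 0"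
        using den[OF pairs(2)] by blast
      obtain pe where pe: "pe \<in> poly_funs n k" "\<forall>v\<in>?V. e v = pe v"
        using num[OF pairs(3)] by blast
      obtain pf where pf: "pf \<in> poly_funs n k" "\<forall>v\<in>?V. f v = pf v"
        using den[OF pairs(3)] by blast
      note eqs = pa(2) pb(2) pd(2) pe(2) pf(2)
      \<comment> \<open>This is \<open>a * f - e * b\<close> as a polynomial function, with the
        difference expressed through sums and products. Multiplied by \<open>d\<close> it becomes
        \<open>c * b * f - c * f * b\<close>, which is zero.\<close>
      define h where "h = (\<lambda>v. pa v * pf v + (- 1) * (pe v * pb v))"
      have h: "h \<in> poly_funs n k"
        unfolding h_def by (intro poly_funs.add poly_funs.mult poly_funs.const pa pb pe pf)
      have "h v * pd v = 0" if v: "v \<in> ?V" for v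
      proof -
        have "a v * d v = c v * b v" "c v * f v = e v * d v" using 1 2 v unfolding rel by auto
        moreover have "(a v * f v - e v * b v) * d v = (a v * d v) * f v - (e v * d v) * b v"
          by (simp add: algebra_simps)
        ultimately have "(a v * f v - e v * b v) * d v = (c v * b v) * f v - (c v * f v) * b v"
          by simp
        then have "(a v * f v - e v * b v) * d v = 0" by (simp only: ac_simps diff_self)
        then show ?thesis using eqs v by (simp add: h_def)
      qed
      then have "\<forall>v\<in>?V. h v = 0"
        using poly_funs_no_zero_divisors[OF h pd(1)] nz by blast
      then have "\<forall>v\<in>?V. a v * f v = e v * b v" using eqs by (simp add: h_def)
      then show "((a, b), (e, f)) \<in> frac_rel ?R" unfolding rel using pairs by blast
    qed
  qed
qed

text \<open>Stated for unions of classes because the sum and product of two fractions are such unions by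
  definition; this makes their well-definedness irrelevant.\<close>
lemma restrict_function_jets:
  assumes "F = (\<Union>i\<in>I. fraction (coord_ring n k (jets n k)) (a i) (b i))"
  shows "restrict_function n k (jets n k) F = F"
proof -
  let ?r = "frac_rel (coord_ring n k (jets n k))"
  note eq = equiv_frac_rel_jets[of n k]
  \<comment> \<open>An image under the equivalence relation is saturated. Restriction leaves each
    representative unchanged and only saturates again.\<close>
  have F: "F = ?r `` ((\<lambda>i. (a i, b i)) ` I)" using assms by (auto simp: fraction_def)
  have sub: "F \<subseteq> frac_pairs (coord_ring n k (jets n k))"
    using F equiv_type[OF eq] by blast
  have restr: "restrict p (jets n k) = p \<and> restrict q (jets n k) = q" if "(p, q) \<in> F" for p q
    using subsetD[OF sub that] by (auto simp: frac_pairs_def coord_ring_def)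
  have "restrict_function n k (jets n k) F = ?r `` F"
    unfolding restrict_function_def fraction_def using restr by auto
  also have "\<dots> = F"
  proof
    show "?r `` F \<subseteq> F"
      unfolding F using eq by (auto simp: equiv_def dest: transD)
    show "F \<subseteq> ?r `` F"
      using sub eq by (auto simp: equiv_def refl_on_def)
  qed
  finally show ?thesis .
qed

text \<open>Restriction fixes the elements of the carrier, the unit, and all sums and products, so
  it acts as the identity. A single class is treated as a union over a one-element index
  set.\<close>

lemma restrict_function_jets_ring_iso:
  "restrict_function n k (jets n k) \<in>
     ring_iso (invariant_functions n k (jets n k) \<Gamma> \<alpha>) (invariant_functions n k (jets n k) \<Gamma> \<alpha>)"
proof -
  let ?R = "coord_ring n k (jets n k)" and ?I = "invariant_functions n k (jets n k) \<Gamma> \<alpha>"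
  let ?\<rho> = "restrict_function n k (jets n k)"
  have carrier: "?\<rho> F = F" if "F \<in> carrier ?I" for F
  proof -
    have "F \<in> frac_pairs ?R // frac_rel ?R"
      using that by (simp add: invariant_functions_def rational_functions_def fraction_field_def)
    then obtain a b where "F = fraction ?R a b" by (auto simp: quotient_def fraction_def)
    then show ?thesis 
      by (intro restrict_function_jets[where I = "{()}" and a = "\<lambda>_. a" and b = "\<lambda>_. b"]) simp
  qed
  \<comment> \<open>Merging the nested unions into one over \<open>F \<times> G\<close> gives sums
    and products the form that \<open>restrict_function_jets\<close> expects.\<close>
  have pairs: "(\<Union>(a, b)\<in>F. \<Union>(c, d)\<in>G. h a b c d) =
      (\<Union>p\<in>F \<times> G. h (fst (fst p)) (snd (fst p)) (fst (snd p)) (snd (snd p)))"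
    for F G and h :: "_ \<Rightarrow> _ \<Rightarrow> _ \<Rightarrow> _ \<Rightarrow> _ set"
    unfolding case_prod_beta by force
  have mult: "?\<rho> (F \<otimes>\<^bsub>?I\<^esub> G) = F \<otimes>\<^bsub>?I\<^esub> G" for F G
    by (rule restrict_function_jets[where I = "F \<times> G"
          and a = "\<lambda>p. fst (fst p) \<otimes>\<^bsub>?R\<^esub> fst (snd p)"
          and b = "\<lambda>p. snd (fst p) \<otimes>\<^bsub>?R\<^esub> snd (snd p)"])
      (simp add: invariant_functions_def rational_functions_def fraction_field_def pairs)
  have add: "?\<rho> (F \<oplus>\<^bsub>?I\<^esub> G) = F \<oplus>\<^bsub>?I\<^esub> G" for F G
    by (rule restrict_function_jets[where I = "F \<times> G"
          and a = "\<lambda>p. (fst (fst p) \<otimes>\<^bsub>?R\<^esub> snd (snd p)) \<oplus>\<^bsub>?R\<^esub> (fst (snd p) \<otimes>\<^bsub>?R\<^esub> snd (fst p))"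
          and b = "\<lambda>p. snd (fst p) \<otimes>\<^bsub>?R\<^esub> snd (snd p)"])
      (simp add: invariant_functions_def rational_functions_def fraction_field_def pairs)
  have one: "?\<rho> \<one>\<^bsub>?I\<^esub> = \<one>\<^bsub>?I\<^esub>"
    by (rule restrict_function_jets[where I = "{()}" and a = "\<lambda>_. \<one>\<^bsub>?R\<^esub>"
          and b = "\<lambda>_. \<one>\<^bsub>?R\<^esub>"])
      (simp add: invariant_functions_def rational_functions_def fraction_field_def)
  have "?\<rho> \<in> Ring.ring_hom ?I ?I"
    by (rule ring_hom_memI) (simp_all add: carrier mult add one)
  moreover have "bij_betw ?\<rho> (carrier ?I) (carrier ?I)"
    using bij_betw_cong[of "carrier ?I" ?\<rho> id "carrier ?I"] carrier by (simp add: bij_betw_id)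
  ultimately show ?thesis by (simp add: ring_iso_def)
qed

theorem corollary4p5:
  fixes n k :: nat and x :: "complex mat" and \<Omega> :: "complex mat set"
  assumes "1 \<le> k" and "1 \<le> n"
    and "generic n k x"
    and "\<Omega> = lie_fixed n k (stab_lie k x)"
  shows "zariski n k (jets n k) closure_of
           (\<Union>g\<in>carrier (reparam_group k). jet_act g ` \<Omega>) = jets n k \<and>
         restrict_function n k \<Omega> \<in>
           ring_iso (invariant_functions n k (jets n k) (carrier (reparam_group k)) jet_act)
                    (invariant_functions n k \<Omega> (carrier (weyl_group k \<Omega>)) weyl_act)"
proof -
  have pos: "0 < k" "0 < n" using assms by auto
  have \<Omega>: "\<Omega> = jets n k"
    using assms(4) stab_lie_generic[OF pos assms(3)] lie_fixed_zero by simp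
  have orbit: "(\<Union>g\<in>carrier (reparam_group k). jet_act g ` jets n k) = jets n k"
  proof
    show "(\<Union>g\<in>carrier (reparam_group k). jet_act g ` jets n k) \<subseteq> jets n k"
      by (auto simp: jets_eq_carrier_mat intro: jet_act_carrier_mat[OF reparam_group_carrier_mat])
    have "v \<in> jet_act (1\<^sub>m k) ` jets n k" if "v \<in> jets n k" for v
      using that jet_act_one by (metis image_eqI jets_eq_carrier_mat)
    then show "jets n k \<subseteq> (\<Union>g\<in>carrier (reparam_group k). jet_act g ` jets n k)"
      \<comment> \<open>The identity alone already sweeps out the whole space, so density becomes
        the closure of the full space.\<close>
      using one_in_reparam_group by blast
  qed
  show ?thesis
    unfolding \<Omega> orbit invariant_functions_weyl_jets[OF pos]
    using closure_of_topspace[of "zariski n k (jets n k)"] restrict_function_jets_ring_iso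
    by (simp add: topspace_zariski)
qed

end
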